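(* Let $u:(0,\infty)\to\mathbb{R}$ be a utility function and let $k\ge 1$ be an integer. Then the following properties hold: (1) For any $p,q\in S_k$ such that $p\ll q$, $$D_u(p\parallel q)=u\!\left(e^{H_u(p\parallel q)}\right)-u(1).$$ (2) For any $p\in S_k$, $$H_u(p)=u_k(1)-u_k\!\left(e^{-h_{u_k}(p)}\right),$$ where $u_k:(0,\infty)\to\mathbb{R}$ is the rescaled utility function $u_k(x):=u(kx)$.
   Context: A utility function is a strictly concave, strictly increasing, continuously differentiable function $u:(0,\infty)\to\mathbb{R}$ such that $\lim_{x\searrow 0}u'(x)=\infty$ and $\lim_{x\nearrow\infty}u'(x)=0$. Put $u(0):=\lim_{x\searrow0}u(x)\in[-\infty,\infty)$. The convention $\infty\cdot 0=-\infty\cdot 0=0$ is used. $S_k=\{p\in\mathbb{R}^k:\ p_i\ge 0,\ \sum_{i=1}^k p_i=1\}$ is identified with the set of probability measures on a $k$-point set; $p\ll q$ means $p_i=0$ whenever $q_i=0$. $p_{(k)}\in S_k$ is the uniform vector, $(p_{(k)})_i=1/k$. Relative $u$-entropy: for $p,q\in S_k$, $H_u(p\parallel q):=\ln u^{-1}(N_u(p\parallel q))$, where $N_u(p\parallel q):=\sup\sum_{i=1}^k u(w_i)p_i$, the supremum being over all $w\in[0,\infty)^k$ with $\sum_{i=1}^k w_iq_i=1$ and $\sum_{i=1}^k u(w_i)^-p_i<\infty$ (where $x^-=\max(-x,0)$). Discrete $u$-entropy: for $p\in S_k$, $h_u(p):=-\ln u^{-1}(n_u(p))$, where $n_u(p):=\sup_{w\in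 S_k}\sum_{i=1}^k u(w_i)p_i$. Friedman–Huang–Sandow $U$-relative entropy: for $p,q\in S_k$ with $p\ll q$, $$D_u(p\parallel q):=\sup_{w\in S_k}\sum_{i=1}^k u\!\left(\frac{w_i}{q_i}\right)p_i-u(1),$$ where terms with $q_i=0$ (hence $p_i=0$) are read as $0$. Friedman–Huang–Sandow $U$-entropy: for $p\in S_k$, $H_u(p):=u(k)-u(1)-D_u(p\parallel p_{(k)})$. *)

theory Defs
  imports "HOL-Analysis.Analysis"
begin

definition strictly_concave_on :: "real set \<Rightarrow> (real \<Rightarrow> real) \<Rightarrow> bool" where
  "strictly_concave_on S f \<longleftrightarrow> convex S \<and>
     (\<forall>x\<in>S. \<forall>y\<in>S. \<forall>t. x \<noteq> y \<longrightarrow> 0 < t \<longrightarrow> t < 1 \<longrightarrow>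
        (1 - t) * f x + t * f y < f ((1 - t) * x + t * y))"

text \<open>Only the values of \<open>u\<close> on \<open>{0<..}\<close> matter, here and in all definitions below.\<close>

definition utility_function :: "(real \<Rightarrow> real) \<Rightarrow> bool" where
  "utility_function u \<longleftrightarrow>
     strictly_concave_on {0<..} u \<and>
     strict_mono_on {0<..} u \<and>
     u C1_differentiable_on {0<..} \<and>
     filterlim (deriv u) at_top (at_right 0) \<and>
     (deriv u \<longlongrightarrow> 0) at_top"

text \<open>
  The extension of \<open>u\<close> by limits to \<open>[0, \<infinity>]\<close>, with values in \<open>[-\<infinity>, \<infinity>]\<close>. The value at \<open>\<infinity>\<close> is
  needed only to make sense of the inverse of \<open>u\<close> when a supremum is not attained
  by \<open>u\<close> at a finite point. Negative arguments are irrelevant.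
\<close>

definition u_ext :: "(real \<Rightarrow> real) \<Rightarrow> ereal \<Rightarrow> ereal" where
  "u_ext u x =
     (if x = 0 then Lim (at_right 0) (\<lambda>t. ereal (u t))
      else if x = \<infinity> then Lim at_top (\<lambda>t. ereal (u t))
      else ereal (u (real_of_ereal x)))"

definition u_inv :: "(real \<Rightarrow> real) \<Rightarrow> ereal \<Rightarrow> ereal" where
  "u_inv u = the_inv_into {0..} (u_ext u)"

function ln_ereal :: "ereal \<Rightarrow> ereal" where
  "ln_ereal (ereal r) = (if r > 0 then ereal (ln r) else -\<infinity>)"
| "ln_ereal \<infinity> = \<infinity>"
| "ln_ereal (-\<infinity>) = -\<infinity>"
  by (auto intro: ereal_cases)
termination by standard (rule wf_on_bot)

function exp_ereal :: "ereal \<Rightarrow> ereal" where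
  "exp_ereal (ereal r) = ereal (exp r)"
| "exp_ereal \<infinity> = \<infinity>"
| "exp_ereal (-\<infinity>) = 0"
  by (auto intro: ereal_cases)
termination by standard (rule wf_on_bot)

text \<open>
  \<open>S\<^sub>k\<close> with \<open>k = CARD('k)\<close>. In the sums below, \<^term>\<open>\<infinity> * 0 = (0::ereal)\<close> and
  \<^term>\<open>-\<infinity> * 0 = (0::ereal)\<close> hold in the library, as required. Terms \<open>u(w\<^sub>i) p\<^sub>i\<close> are
  never \<open>+\<infinity>\<close> as \<open>w\<^sub>i\<close> is finite, so the sums are never of the form \<open>\<infinity> - \<infinity>\<close>.
\<close>

definition prob_simplex :: "(real ^ 'k) set" where
  "prob_simplex = {p. (\<forall>i. 0 \<le> p $ i) \<and> (\<Sum>i\<in>UNIV. p $ i) = 1}"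

definition abs_cont :: "real ^ 'k \<Rightarrow> real ^ 'k \<Rightarrow> bool" where
  "abs_cont p q \<longleftrightarrow> (\<forall>i. q $ i = 0 \<longrightarrow> p $ i = 0)"

definition uniform_vec :: "real ^ 'k" where
  "uniform_vec = (\<chi> i. 1 / real CARD('k))"

definition rel_N :: "(real \<Rightarrow> real) \<Rightarrow> real ^ 'k \<Rightarrow> real ^ 'k \<Rightarrow> ereal" where
  "rel_N u p q =
     (SUP w \<in> {w :: real ^ 'k. (\<forall>i. 0 \<le> w $ i) \<and> (\<Sum>i\<in>UNIV. w $ i * q $ i) = 1 \<and>
                 (\<Sum>i\<in>UNIV. max (- u_ext u (ereal (w $ i))) 0 * ereal (p $ i)) < \<infinity>}.
        \<Sum>i\<in>UNIV. u_ext u (ereal (w $ i)) * ereal (p $ i))"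

definition rel_u_entropy :: "(real \<Rightarrow> real) \<Rightarrow> real ^ 'k \<Rightarrow> real ^ 'k \<Rightarrow> ereal" where
  "rel_u_entropy u p q = ln_ereal (u_inv u (rel_N u p q))"

definition disc_n :: "(real \<Rightarrow> real) \<Rightarrow> real ^ 'k \<Rightarrow> ereal" where
  "disc_n u p =
     (SUP w \<in> prob_simplex. \<Sum>i\<in>UNIV. u_ext u (ereal (w $ i)) * ereal (p $ i))"

definition disc_u_entropy :: "(real \<Rightarrow> real) \<Rightarrow> real ^ 'k \<Rightarrow> ereal" where
  "disc_u_entropy u p = - ln_ereal (u_inv u (disc_n u p))"

definition FHS_rel_entropy :: "(real \<Rightarrow> real) \<Rightarrow> real ^ 'k \<Rightarrow> real ^ 'k \<Rightarrow> ereal" where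
  "FHS_rel_entropy u p q =
     (SUP w \<in> prob_simplex.
        \<Sum>i\<in>UNIV. if q $ i = 0 then 0 else u_ext u (ereal (w $ i / q $ i)) * ereal (p $ i))
     - ereal (u 1)"

definition FHS_entropy :: "(real \<Rightarrow> real) \<Rightarrow> real ^ 'k \<Rightarrow> ereal" where
  "FHS_entropy u p =
     ereal (u (real CARD('k))) - ereal (u 1) - FHS_rel_entropy u p uniform_vec"

definition rescaled :: "(real \<Rightarrow> real) \<Rightarrow> real \<Rightarrow> real \<Rightarrow> real" where
  "rescaled u c = (\<lambda>x. u (c * x))"

end

theory Submission
  imports Defs
begin

text \<open>
  Every entropy here is a supremum \<open>s\<close> of sums \<open>\<Sum> u(w\<^sub>i) p\<^sub>i\<close>, and the constant choice of \<open>w\<close>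
  together with averaging gives \<open>u 1 \<le> s \<le> u \<infinity>\<close>. Hence \<open>s\<close> lies in the range of the extended \<open>u\<close>
  and \<open>u (u\<^sup>-\<^sup>1 s) = s\<close>, so that both identities reduce to comparing the suprema by the
  substitutions \<open>w\<^sub>i \<mapsto> w\<^sub>i / q\<^sub>i\<close> and \<open>w\<^sub>i \<mapsto> k w\<^sub>i\<close>.
\<close>

section \<open>The utility extended to 0 and infinity\<close>

lemma u_ext_ereal: "x > 0 \<Longrightarrow> u_ext u (ereal x) = ereal (u x)"
  by (simp add: u_ext_def)

text \<open>By monotonicity the one-sided limit exists and is an infimum. This gives the bare
  \<open>Lim\<close> in \<open>u_ext\<close> its meaning and reduces boundary values to order
  arguments.\<close>

lemma u_ext_0:
  assumes "strict_mono_on {0<..} u"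
  shows "u_ext u 0 = (INF t\<in>{0<..}. ereal (u t))" (is "_ = ?L")
proof -
  have "((\<lambda>t. ereal (u t)) \<longlongrightarrow> ?L) (at_right 0)"
  proof (rule order_tendstoI)
    fix a assume "a < ?L"
    then have "a < ereal (u t)" if "t > 0" for t
      using that by (meson INF_lower greaterThan_iff less_le_trans)
    then show "\<forall>\<^sub>F t in at_right 0. a < ereal (u t)"
      by (simp add: eventually_at_right_less[THEN eventually_mono])
  next
    fix a assume "?L < a"
    then obtain s where s: "s > 0" "ereal (u s) < a"
      by (auto simp: INF_less_iff)
    have "ereal (u t) < a" if "0 < t" "t < s" for t
      using strict_mono_onD[OF assms, of t s] that s less_trans[of "ereal (u t)" "ereal (u s)" a]
      by simp
    then show "\<forall>\<^sub>F t in at_right 0. ereal (u t) < a"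
      using s(1) by (auto simp: eventually_at_right_field)
  qed
  then show ?thesis
    by (simp add: u_ext_def tendsto_Lim)
qed

lemma u_ext_PInf:
  assumes "strict_mono_on {0<..} u"
  shows "u_ext u \<infinity> = (SUP t\<in>{0<..}. ereal (u t))" (is "_ = ?L")
proof -
  have "((\<lambda>t. ereal (u t)) \<longlongrightarrow> ?L) at_top"
  proof (rule order_tendstoI)
    fix a assume "?L < a"
    then have "ereal (u t) < a" if "t > 0" for t
      using that by (meson SUP_upper greaterThan_iff le_less_trans)
    then show "\<forall>\<^sub>F t in at_top. ereal (u t) < a"
      by (rule eventually_mono[OF eventually_gt_at_top])
  next
    fix a assume "a < ?L"
    then obtain s where s: "s > 0" "a < ereal (u s)"
      by (auto simp: less_SUP_iff)
    have "a < ereal (u t)" if "s < t" for t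
      using strict_mono_onD[OF assms, of s t] that s less_trans[of a "ereal (u s)" "ereal (u t)"]
      by simp
    then show "\<forall>\<^sub>F t in at_top. a < ereal (u t)"
      by (rule eventually_mono[OF eventually_gt_at_top])
  qed
  then show ?thesis
    by (simp add: u_ext_def tendsto_Lim)
qed

text \<open>Two reals \<open>a < b\<close> are inserted strictly between \<open>x\<close> and
  \<open>y\<close>. Strictness comes from \<open>u a < u b\<close> alone, so at the ends 0 and
  infinity the weak bounds given by the infimum and the supremum suffice.\<close>

lemma u_ext_less:
  assumes u: "strict_mono_on {0<..} u" and "0 \<le> x" "x < y"
  shows "u_ext u x < u_ext u y"
proof -
  obtain a b where ab: "x < ereal a" "a < b" "ereal b < y"
    using \<open>x < y\<close> by (meson ereal_dense2 ereal_less_eq(3) less_ereal.simps(1))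
  then have "0 < a" "0 < b"
    using \<open>0 \<le> x\<close> by (auto simp flip: ereal_less(2) intro: le_less_trans less_trans)
  have "u_ext u x \<le> ereal (u a)"
  proof (cases "x = 0")
    case True
    then show ?thesis
      using \<open>0 < a\<close> by (auto simp: u_ext_0[OF u] intro: INF_lower)
  next
    case False
    then obtain r where "x = ereal r" "0 < r" "r < a"
      using \<open>0 \<le> x\<close> ab by (cases x) auto
    then show ?thesis
      using strict_mono_onD[OF u, of r a] by (simp add: u_ext_ereal)
  qed
  also have "ereal (u a) < ereal (u b)"
    using strict_mono_onD[OF u] \<open>0 < a\<close> \<open>a < b\<close> by simp
  also have "ereal (u b) \<le> u_ext u y"
  proof (cases "y = \<infinity>")
    case True
    then show ?thesis
      using \<open>0 < b\<close> by (auto simp: u_ext_PInf[OF u] intro: SUP_upper)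
  next
    case False
    then obtain r where "y = ereal r" "b < r"
      using ab by (cases y) auto
    then show ?thesis
      using strict_mono_onD[OF u, of b r] \<open>0 < b\<close> by (simp add: u_ext_ereal)
  qed
  finally show ?thesis .
qed

lemma u_ext_mono:
  assumes "strict_mono_on {0<..} u" "0 \<le> x" "x \<le> y"
  shows "u_ext u x \<le> u_ext u y"
  using assms u_ext_less[of u x y] by (cases "x = y") (auto simp: less_le)

lemma u_ext_less_PInf:
  assumes "strict_mono_on {0<..} u" "0 \<le> x"
  shows "u_ext u (ereal x) < \<infinity>"
  using u_ext_less[of u "ereal x" \<infinity>] assms by (auto intro: less_le_trans)

text \<open>The range of the extended utility contains everything from \<open>u a\<close> up to its
  value at infinity: that top value is attained at infinity, and any smaller \<open>y\<close> is
  below some \<open>u b\<close>, so the intermediate value theorem applies on \<open>{a..b}\<close>.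
  Injectivity then makes \<open>u_inv\<close> a genuine right inverse at \<open>y\<close>.\<close>

lemma u_ext_u_inv:
  assumes u: "strict_mono_on {0<..} u" "continuous_on {0<..} u"
    and a: "0 < a" "ereal (u a) \<le> y" and y: "y \<le> u_ext u \<infinity>"
  shows "0 \<le> u_inv u y" "u_ext u (u_inv u y) = y"
proof -
  have inj: "inj_on (u_ext u) {0..}"
    by (rule strict_mono_on_imp_inj_on) (auto intro!: strict_mono_onI u_ext_less[OF u(1)])
  have "y \<in> u_ext u ` {0..}"
  proof (cases "y = u_ext u \<infinity>")
    case False
    with y have "y < (SUP t\<in>{0<..}. ereal (u t))"
      by (simp add: u_ext_PInf[OF u(1)])
    then obtain b where b: "0 < b" "y < ereal (u b)"
      by (auto simp: less_SUP_iff)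
    obtain z where z: "y = ereal z"
      using a b by (cases y) auto
    have "a < b"
    proof (rule ccontr)
      assume "\<not> a < b"
      then have "u b \<le> u a"
        using strict_mono_onD[OF u(1), of b a] b by (cases "a = b") auto
      then show False using a b z by simp
    qed
    then obtain x where x: "a \<le> x" "u x = z"
      using IVT'[of u a z b] a b z continuous_on_subset[OF u(2), of "{a..b}"] by force
    then show ?thesis
      using a z by (intro image_eqI[of _ _ "ereal x"]) (auto simp: u_ext_ereal)
  qed simp
  then show "0 \<le> u_inv u y" "u_ext u (u_inv u y) = y"
    using the_inv_into_into[OF inj] f_the_inv_into_f[OF inj] by (auto simp: u_inv_def)
qed

lemma exp_ereal_ln_ereal: "0 \<le> x \<Longrightarrow> exp_ereal (ln_ereal x) = x"
  by (cases x) (auto simp: zero_ereal_def)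

section \<open>Averages against a probability vector\<close>

lemma prob_simplex_average_le:
  fixes y :: "'k::finite \<Rightarrow> ereal"
  assumes p: "p \<in> prob_simplex" and y: "\<And>i. y i \<le> M" and "M \<noteq> -\<infinity>"
  shows "(\<Sum>i\<in>UNIV. y i * ereal (p $ i)) \<le> M"
proof (cases M)
  case (real m)
  have "(\<Sum>i\<in>UNIV. y i * ereal (p $ i)) \<le> (\<Sum>i\<in>UNIV. M * ereal (p $ i))"
    using p y by (intro sum_mono ereal_mult_right_mono) (auto simp: prob_simplex_def)
  also have "\<dots> = ereal (m * (\<Sum>i\<in>UNIV. p $ i))"
    by (simp add: real sum_distrib_left)
  finally show ?thesis
    using p by (simp add: prob_simplex_def real)
qed (use assms in auto)

lemma prob_simplex_average_const:
  "p \<in> prob_simplex \<Longrightarrow> (\<Sum>i\<in>UNIV. ereal c * ereal (p $ i)) = ereal c"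
  by (simp add: prob_simplex_def flip: sum_distrib_left)

text \<open>An infinite negative part forces \<open>y i = -\<infinity>\<close> at some
  \<open>i\<close> of positive weight, which drags the whole sum to minus infinity. Hence the side
  condition in \<open>rel_N\<close> can only exclude vectors whose sum is minus infinity, and these
  do not affect the supremum.\<close>

lemma sum_neg_part_finite:
  fixes y :: "'k::finite \<Rightarrow> ereal"
  assumes p: "\<And>i. 0 \<le> p i" and y: "\<And>i. y i < \<infinity>"
    and fin: "(\<Sum>i\<in>UNIV. y i * ereal (p i)) \<noteq> -\<infinity>"
  shows "(\<Sum>i\<in>UNIV. max (- y i) 0 * ereal (p i)) < \<infinity>"
proof (rule ccontr)
  assume "\<not> ?thesis"
  then obtain i where i: "max (- y i) 0 * ereal (p i) = \<infinity>"
    by (auto simp: sum_Pinfty)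
  then have "y i = -\<infinity>" "0 < p i"
    using p[of i] y[of i] by (cases "y i"; auto simp: max_def split: if_splits)+
  \<comment> \<open>No other term can be plus infinity, so the infinite term at \<open>i\<close> is
    not cancelled.\<close>
  moreover have "y j * ereal (p j) < \<infinity>" for j
    using y[of j] p[of j] by (cases "y j"; cases "p j = 0") auto
  then have "(\<Sum>j\<in>UNIV - {i}. y j * ereal (p j)) \<noteq> \<infinity>"
    by (auto simp: sum_Pinfty less_le)
  ultimately have "(\<Sum>j\<in>UNIV. y j * ereal (p j)) = -\<infinity>"
    by (simp add: sum.remove[of UNIV i])
  with fin show False by simp
qed

section \<open>Bounds and comparison of the suprema\<close>

lemma rel_N_bounds:
  fixes p q :: "real ^ 'k"
  assumes u: "strict_mono_on {0<..} u" and p: "p \<in> prob_simplex" and q: "q \<in> prob_simplex"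
  shows "ereal (u 1) \<le> rel_N u p q" "rel_N u p q \<le> u_ext u \<infinity>"
proof -
  have q1: "(\<Sum>i\<in>UNIV. q $ i) = 1" and p0: "\<And>i. 0 \<le> p $ i"
    using p q by (auto simp: prob_simplex_def)
  have fin: "(\<Sum>i\<in>UNIV. max (- u_ext u (ereal ((\<chi> i. 1) $ i))) 0 * ereal (p $ i)) < \<infinity>"
    using prob_simplex_average_const[OF p] u_ext_less_PInf[OF u]
    by (intro sum_neg_part_finite p0) (auto simp: u_ext_ereal)
  show "ereal (u 1) \<le> rel_N u p q"
    unfolding rel_N_def
    using q1 fin prob_simplex_average_const[OF p, of "u 1"]
    by (intro SUP_upper2[of "\<chi> i. 1"]) (auto simp: u_ext_ereal)
  have "u_ext u \<infinity> \<noteq> -\<infinity>"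
    using u_ext_less[OF u, of 0 \<infinity>] by auto
  then show "rel_N u p q \<le> u_ext u \<infinity>"
    unfolding rel_N_def
    by (intro SUP_least prob_simplex_average_le[OF p] u_ext_mono[OF u]) auto
qed

text \<open>The constant choice inside the simplex is the uniform vector, whence the argument
  \<open>1 / k\<close>; for the rescaled utility this lower bound becomes
  \<open>u 1\<close>.\<close>

lemma disc_n_bounds:
  fixes p :: "real ^ 'k"
  assumes u: "strict_mono_on {0<..} u" and p: "p \<in> prob_simplex"
  shows "ereal (u (1 / real CARD('k))) \<le> disc_n u p" "disc_n u p \<le> u_ext u \<infinity>"
proof -
  show "ereal (u (1 / real CARD('k))) \<le> disc_n u p"
    unfolding disc_n_def
    using prob_simplex_average_const[OF p, of "u (1 / real CARD('k))"]
    by (intro SUP_upper2[of uniform_vec])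
      (auto simp: u_ext_ereal prob_simplex_def uniform_vec_def)
  have "u_ext u \<infinity> \<noteq> -\<infinity>"
    using u_ext_less[OF u, of 0 \<infinity>] by auto
  then show "disc_n u p \<le> u_ext u \<infinity>"
    unfolding disc_n_def
    by (intro SUP_least prob_simplex_average_le[OF p] u_ext_mono[OF u])
      (auto simp: prob_simplex_def)
qed

text \<open>Multiplication by \<open>q\<close> carries the constraint of \<open>rel_N\<close> into
  the simplex. Division by \<open>q\<close> goes back only up to the null set of \<open>q\<close>,
  where absolute continuity makes \<open>p\<close> vanish too, so that one inequality needs a
  correction.\<close>

lemma FHS_rel_entropy_eq_rel_N:
  fixes p q :: "real ^ 'k"
  assumes u: "strict_mono_on {0<..} u" and p: "p \<in> prob_simplex" and q: "q \<in> prob_simplex"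
    and pq: "abs_cont p q"
  shows "FHS_rel_entropy u p q = rel_N u p q - ereal (u 1)"
proof -
  define S where
    "S w = (\<Sum>i\<in>UNIV. if q $ i = 0 then 0 else u_ext u (ereal (w $ i / q $ i)) * ereal (p $ i))"
    for w :: "real ^ 'k"
  define T where "T w = (\<Sum>i\<in>UNIV. u_ext u (ereal (w $ i)) * ereal (p $ i))" for w :: "real ^ 'k"
  have p0: "0 \<le> p $ i" and q0: "0 \<le> q $ i" and q1: "(\<Sum>i\<in>UNIV. q $ i) = 1" for i
    using p q by (auto simp: prob_simplex_def)
  have pz: "p $ i = 0" if "q $ i = 0" for i
    using pq that by (simp add: abs_cont_def)
  have le: "S w \<le> rel_N u p q" if w: "w \<in> prob_simplex" for w
  proof -
    have w0: "0 \<le> w $ i" and w1: "(\<Sum>i\<in>UNIV. w $ i) = 1" for i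
      using w by (auto simp: prob_simplex_def)
    \<comment> \<open>\<open>w / q\<close> loses the mass that \<open>w\<close> puts on the null set of \<open>q\<close>; it is returned as a constant.\<close>
    define s where "s = (\<Sum>i\<in>UNIV. if q $ i = 0 then 0 else w $ i)"
    define v :: "real ^ 'k" where "v = (\<chi> i. w $ i / q $ i + (1 - s))"
    have "s \<le> (\<Sum>i\<in>UNIV. w $ i)"
      unfolding s_def using w0 by (intro sum_mono) auto
    then have s1: "s \<le> 1" by (simp add: w1)
    have v0: "0 \<le> v $ i" for i
      using w0 q0 s1 by (simp add: v_def)
    \<comment> \<open>Where \<open>q $ i = 0\<close> both sides vanish; elsewhere
      \<open>q $ i\<close> cancels.\<close>
    have "(\<Sum>i\<in>UNIV. v $ i * q $ i) = (\<Sum>i\<in>UNIV. (if q $ i = 0 then 0 else w $ i) + (1 - s) * q $ i)"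
      by (intro sum.cong) (auto simp: v_def field_simps)
    also have "\<dots> = 1"
      by (simp add: sum.distrib s_def[symmetric] q1 flip: sum_distrib_left)
    finally have v1: "(\<Sum>i\<in>UNIV. v $ i * q $ i) = 1" .
    \<comment> \<open>Adding \<open>1 - s\<close>, which is nonnegative, can only raise the utility,
      and coordinates with \<open>q $ i = 0\<close> carry weight \<open>p $ i = 0\<close>.\<close>
    have "S w \<le> T v"
      unfolding S_def T_def
      using w0 q0 p0 s1
      by (intro sum_mono) (auto simp: v_def pz simp flip: zero_ereal_def intro!: ereal_mult_right_mono u_ext_mono[OF u])
    moreover have "T v \<le> rel_N u p q"
    proof (cases "T v = -\<infinity>")
      case False
      then have "(\<Sum>i\<in>UNIV. max (- u_ext u (ereal (v $ i))) 0 * ereal (p $ i)) < \<infinity>"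
        unfolding T_def using v0 p0 by (intro sum_neg_part_finite u_ext_less_PInf[OF u])
      with v0 v1 show ?thesis
        unfolding rel_N_def T_def by (intro SUP_upper) auto
    qed simp
    ultimately show ?thesis by simp
  qed
  have ge: "T w \<le> (SUP v\<in>prob_simplex. S v)"
    if w: "\<And>i. 0 \<le> w $ i" "(\<Sum>i\<in>UNIV. w $ i * q $ i) = 1" for w
  proof -
    define v :: "real ^ 'k" where "v = (\<chi> i. w $ i * q $ i)"
    have "v \<in> prob_simplex"
      using w q0 by (simp add: v_def prob_simplex_def)
    \<comment> \<open>Off the null set of \<open>q\<close> the quotient \<open>v $ i / q $ i\<close>
      recovers \<open>w $ i\<close>; on it the term of \<open>T\<close> has weight zero.\<close>
    moreover have "T w = S v"
      unfolding T_def S_def by (intro sum.cong) (auto simp: v_def pz)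
    ultimately show ?thesis by (simp add: SUP_upper)
  qed
  have "(SUP w\<in>prob_simplex. S w) = rel_N u p q"
  proof (rule antisym)
    show "(SUP w\<in>prob_simplex. S w) \<le> rel_N u p q"
      by (rule SUP_least) (rule le)
    show "rel_N u p q \<le> (SUP w\<in>prob_simplex. S w)"
      unfolding rel_N_def by (rule SUP_least) (use ge in \<open>auto simp: T_def\<close>)
  qed
  then show ?thesis
    by (simp add: FHS_rel_entropy_def S_def)
qed

section \<open>Rescaling the argument of the utility\<close>

lemma strict_mono_on_rescaled:
  "strict_mono_on {0<..} u \<Longrightarrow> c > 0 \<Longrightarrow> strict_mono_on {0<..} (rescaled u c)"
  unfolding rescaled_def
  by (rule strict_mono_onI) (simp add: strict_mono_onD[of "{0<..}" u])

lemma continuous_on_rescaled: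
  "continuous_on {0<..} u \<Longrightarrow> c > 0 \<Longrightarrow> continuous_on {0<..} (rescaled u c)"
  unfolding rescaled_def
  by (rule continuous_on_compose2[where g = u and t = "{0<..}"]) (auto intro!: continuous_intros)

lemma u_ext_rescaled:
  assumes u: "strict_mono_on {0<..} u" and c: "c > 0" and "0 \<le> x"
  shows "u_ext (rescaled u c) (ereal x) = u_ext u (ereal (c * x))"
proof (cases "x = 0")
  case True
  \<comment> \<open>Scaling permutes the positive half-line, so the infimum that defines the value
    at 0 is unchanged.\<close>
  have "(*) c ` {0<..} = {0<..}"
  proof
    show "{0<..} \<subseteq> (*) c ` {0<..}"
      using c by (auto intro!: image_eqI[of _ _ "_ / c"])
  qed (use c in auto)
  then have "(INF t\<in>{0<..}. ereal (u (c * t))) = (INF t\<in>{0<..}. ereal (u t))"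
    by (metis (no_types, lifting) INF_cong comp_apply image_comp)
  then show ?thesis
    using True u_ext_0[OF u] u_ext_0[OF strict_mono_on_rescaled[OF u c]]
    by (simp add: rescaled_def flip: zero_ereal_def)
next
  case False
  then show ?thesis
    using assms by (simp add: u_ext_ereal rescaled_def)
qed

text \<open>Dividing by the uniform weight \<open>1 / k\<close> multiplies by \<open>k\<close>,
  which the rescaled utility absorbs; no coordinate of the uniform vector is null.\<close>

lemma FHS_rel_entropy_uniform:
  fixes p :: "real ^ 'k"
  assumes "strict_mono_on {0<..} u"
  shows "FHS_rel_entropy u p uniform_vec = disc_n (rescaled u (real CARD('k))) p - ereal (u 1)"
proof -
  have "u_ext u (ereal (w $ i * real CARD('k))) = u_ext (rescaled u (real CARD('k))) (ereal (w $ i))"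
    if "w \<in> prob_simplex" for w :: "real ^ 'k" and i
    using that by (simp add: u_ext_rescaled[OF assms] prob_simplex_def mult.commute)
  then show ?thesis
    by (simp add: FHS_rel_entropy_def disc_n_def uniform_vec_def cong: SUP_cong)
qed

section \<open>The two identities\<close>

theorem proposition4p5:
  fixes u :: "real \<Rightarrow> real"
  assumes "utility_function u"
  shows "(\<forall>p \<in> prob_simplex. \<forall>q \<in> (prob_simplex :: (real ^ 'k) set). abs_cont p q \<longrightarrow>
           FHS_rel_entropy u p q = u_ext u (exp_ereal (rel_u_entropy u p q)) - ereal (u 1)) \<and>
         (\<forall>p \<in> (prob_simplex :: (real ^ 'k) set).
           FHS_entropy u p =
             ereal (rescaled u (real CARD('k)) 1)
             - u_ext (rescaled u (real CARD('k)))
                 (exp_ereal (- disc_u_entropy (rescaled u (real CARD('k))) p)))"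
proof -
  have u: "strict_mono_on {0<..} u" "continuous_on {0<..} u"
    using assms unfolding utility_function_def
    by (metis, metis C1_differentiable_imp_continuous_on)
  have "FHS_rel_entropy u p q = u_ext u (exp_ereal (rel_u_entropy u p q)) - ereal (u 1)"
    if pq: "p \<in> prob_simplex" "q \<in> prob_simplex" "abs_cont p q" for p q :: "real ^ 'k"
  proof -
    note inv = u_ext_u_inv[OF u zero_less_one rel_N_bounds[OF u(1) pq(1,2)]]
    have "u_ext u (exp_ereal (rel_u_entropy u p q)) = rel_N u p q"
      unfolding rel_u_entropy_def exp_ereal_ln_ereal[OF inv(1)] by (rule inv(2))
    then show ?thesis
      using FHS_rel_entropy_eq_rel_N[OF u(1) pq] by simp
  qed
  moreover have "FHS_entropy u p = ereal (rescaled u (real CARD('k)) 1)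
      - u_ext (rescaled u (real CARD('k)))
          (exp_ereal (- disc_u_entropy (rescaled u (real CARD('k))) p))"
    if p: "p \<in> prob_simplex" for p :: "real ^ 'k"
  proof -
    let ?v = "rescaled u (real CARD('k))"
    have v: "strict_mono_on {0<..} ?v" "continuous_on {0<..} ?v"
      using u by (simp_all add: strict_mono_on_rescaled continuous_on_rescaled)
    have "0 < 1 / real CARD('k)" by simp
    note inv = u_ext_u_inv[OF v this disc_n_bounds[OF v(1) p]]
    have "u_ext ?v (exp_ereal (- disc_u_entropy ?v p)) = disc_n ?v p"
      unfolding disc_u_entropy_def ereal_uminus_uminus exp_ereal_ln_ereal[OF inv(1)] by (rule inv(2))
    \<comment> \<open>Here \<open>?v 1\<close> is \<open>u k\<close>, and the finite term
      \<open>u 1\<close> cancels; the case split checks this cancellation in the extended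
      reals.\<close>
    moreover have "FHS_entropy u p = ereal (?v 1) - disc_n ?v p"
      unfolding FHS_entropy_def FHS_rel_entropy_uniform[OF u(1)]
      by (cases "disc_n ?v p") (auto simp: rescaled_def)
    ultimately show ?thesis by simp
  qed
  ultimately show ?thesis by blast
qed

end
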